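(* Let $R>0$, $i\in\{1,\dots,N\}$, $p>1$ and $C\ge0$. Let $u\in\mathrm{USC}(B_R\setminus\{0\})$ be a radial and locally bounded viscosity subsolution of $$-\lambda_i(D^2u)+|Du|^p=C\quad\text{in }B_R\setminus\{0\}.$$ Then for any open sets $\omega\subset\subset\omega'\subset\subset B_R\setminus\{0\}$ there exists a positive constant $L$, depending only on $p$, $C$, $\mathrm{dist}(\omega,\partial\omega')$ and $\|u\|_{L^\infty(\omega')}$, such that $$|u(x)-u(y)|\le L|x-y|\quad\text{for all }x,y\in\omega.$$
   Context: $B_R\subset\mathbb{R}^N$ is the open ball of radius $R$ centered at $0$; $A\subset\subset B$ means that $\overline A$ is compact and contained in $B$. For a real symmetric $N\times N$ matrix $X$, $\lambda_1(X)\le\dots\le\lambda_N(X)$ denote its eigenvalues in nondecreasing order. $\mathrm{USC}(\Omega)$ is the set of real-valued upper semicontinuous functions on $\Omega$. A function $u\in\mathrm{USC}(\Omega)$ is a viscosity subsolution of $-\lambda_i(D^2u)+|Du|^p=C$ in $\Omega$ if, whenever $\varphi$ is $C^2$ and $u-\varphi$ has a local maximum at $x\in\Omega$, one has $-\lambda_i(D^2\varphi(x))+|D\varphi(x)|^p\le C$. Radial means that $u(x)$ depends only on $|x|$. *)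

theory Defs
  imports "HOL-Analysis.Analysis" "Jordan_Normal_Form.Char_Poly"
begin

text \<open>
  The Lipschitz constant must not depend on the dimension \<open>N\<close>, so \<open>N\<close> has to be a variable that can
  be quantified inside the statement, and a type-indexed space such as \<open>real ^ 'n\<close> cannot be used.
  Points of \<open>\<real>\<^sup>N\<close> are the functions in \<open>{..<N} \<rightarrow>\<^sub>E UNIV\<close>: coordinates are \<open>0, \<dots>, N - 1\<close>, and the
  function is \<open>undefined\<close> elsewhere. With this convention the topology and the Lebesgue measure are
  the library products, and \<open>x(j := t)\<close> stays in the space for \<open>j < N\<close>.
\<close>

abbreviation Rn :: "nat \<Rightarrow> (nat \<Rightarrow> real) topology" where
  "Rn N \<equiv> powertop_real {..<N}"

abbreviation lebesgue_Rn :: "nat \<Rightarrow> (nat \<Rightarrow> real) measure" where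
  "lebesgue_Rn N \<equiv> Pi\<^sub>M {..<N} (\<lambda>_. lborel)"

definition origin :: "nat \<Rightarrow> nat \<Rightarrow> real" where
  "origin N = (\<lambda>j\<in>{..<N}. 0)"

definition enorm :: "nat \<Rightarrow> (nat \<Rightarrow> real) \<Rightarrow> real" where
  "enorm N x = L2_set x {..<N}"

definition edist :: "nat \<Rightarrow> (nat \<Rightarrow> real) \<Rightarrow> (nat \<Rightarrow> real) \<Rightarrow> real" where
  "edist N x y = L2_set (\<lambda>j. x j - y j) {..<N}"

definition set_dist :: "nat \<Rightarrow> (nat \<Rightarrow> real) set \<Rightarrow> (nat \<Rightarrow> real) set \<Rightarrow> real" where
  "set_dist N A B = Inf {edist N x y | x y. x \<in> A \<and> y \<in> B}"

definition punctured_ball :: "nat \<Rightarrow> real \<Rightarrow> (nat \<Rightarrow> real) set" where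
  "punctured_ball N R = {x \<in> topspace (Rn N). enorm N x < R} - {origin N}"

definition compactly_contained :: "nat \<Rightarrow> (nat \<Rightarrow> real) set \<Rightarrow> (nat \<Rightarrow> real) set \<Rightarrow> bool" where
  "compactly_contained N A B \<longleftrightarrow> compactin (Rn N) (Rn N closure_of A) \<and> Rn N closure_of A \<subseteq> B"

text \<open>\<open>lebesgue_Rn\<close> is Lebesgue measure on the Borel sets; completing it does not change the meaning
  of \<open>AE\<close>.\<close>

definition Linf_norm :: "nat \<Rightarrow> (nat \<Rightarrow> real) set \<Rightarrow> ((nat \<Rightarrow> real) \<Rightarrow> real) \<Rightarrow> real" where
  "Linf_norm N S u = Inf {M. 0 \<le> M \<and> (AE x in lebesgue_Rn N. x \<in> S \<longrightarrow> \<bar>u x\<bar> \<le> M)}"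

definition partial :: "nat \<Rightarrow> ((nat \<Rightarrow> real) \<Rightarrow> real) \<Rightarrow> (nat \<Rightarrow> real) \<Rightarrow> real" where
  "partial j \<phi> x = deriv (\<lambda>t. \<phi> (x(j := t))) (x j)"

definition has_partial_on ::
  "nat \<Rightarrow> ((nat \<Rightarrow> real) \<Rightarrow> real) \<Rightarrow> (nat \<Rightarrow> real) set \<Rightarrow> bool" where
  "has_partial_on j \<phi> \<Omega> \<longleftrightarrow> (\<forall>x\<in>\<Omega>. (\<lambda>t. \<phi> (x(j := t))) field_differentiable at (x j))"

definition C2_on :: "nat \<Rightarrow> (nat \<Rightarrow> real) set \<Rightarrow> ((nat \<Rightarrow> real) \<Rightarrow> real) \<Rightarrow> bool" where
  "C2_on N \<Omega> \<phi> \<longleftrightarrow>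
     continuous_map (subtopology (Rn N) \<Omega>) euclideanreal \<phi> \<and>
     (\<forall>j<N. has_partial_on j \<phi> \<Omega> \<and>
        continuous_map (subtopology (Rn N) \<Omega>) euclideanreal (partial j \<phi>) \<and>
        (\<forall>k<N. has_partial_on k (partial j \<phi>) \<Omega> \<and>
           continuous_map (subtopology (Rn N) \<Omega>) euclideanreal (partial k (partial j \<phi>))))"

definition gradient :: "nat \<Rightarrow> ((nat \<Rightarrow> real) \<Rightarrow> real) \<Rightarrow> (nat \<Rightarrow> real) \<Rightarrow> nat \<Rightarrow> real" where
  "gradient N \<phi> x = (\<lambda>j\<in>{..<N}. partial j \<phi> x)"

definition hessian :: "nat \<Rightarrow> ((nat \<Rightarrow> real) \<Rightarrow> real) \<Rightarrow> (nat \<Rightarrow> real) \<Rightarrow> real mat" where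
  "hessian N \<phi> x = mat N N (\<lambda>(j, k). partial j (partial k \<phi>) x)"

text \<open>The \<open>i\<close>-th eigenvalue, \<open>1 \<le> i \<le> N\<close>, of a real symmetric \<open>N \<times> N\<close> matrix, in nondecreasing order
  and counted with multiplicity; a symmetric matrix has \<open>N\<close> real eigenvalues, so the list is long
  enough.\<close>

definition eigval :: "nat \<Rightarrow> real mat \<Rightarrow> real" where
  "eigval i X = sorted_list_of_multiset (proots (char_poly X)) ! (i - 1)"

definition usc_on :: "nat \<Rightarrow> (nat \<Rightarrow> real) set \<Rightarrow> ((nat \<Rightarrow> real) \<Rightarrow> real) \<Rightarrow> bool" where
  "usc_on N \<Omega> u \<longleftrightarrow> (\<forall>a. openin (subtopology (Rn N) \<Omega>) {x \<in> \<Omega>. u x < a})"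

definition locally_bounded_on ::
  "nat \<Rightarrow> (nat \<Rightarrow> real) set \<Rightarrow> ((nat \<Rightarrow> real) \<Rightarrow> real) \<Rightarrow> bool" where
  "locally_bounded_on N \<Omega> u \<longleftrightarrow>
     (\<forall>x\<in>\<Omega>. \<exists>U. openin (Rn N) U \<and> x \<in> U \<and> bounded (u ` (U \<inter> \<Omega>)))"

definition radial_on :: "nat \<Rightarrow> (nat \<Rightarrow> real) set \<Rightarrow> ((nat \<Rightarrow> real) \<Rightarrow> real) \<Rightarrow> bool" where
  "radial_on N \<Omega> u \<longleftrightarrow> (\<forall>x\<in>\<Omega>. \<forall>y\<in>\<Omega>. enorm N x = enorm N y \<longrightarrow> u x = u y)"

definition local_max_at ::
  "nat \<Rightarrow> (nat \<Rightarrow> real) set \<Rightarrow> ((nat \<Rightarrow> real) \<Rightarrow> real) \<Rightarrow> (nat \<Rightarrow> real) \<Rightarrow> bool" where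
  "local_max_at N \<Omega> f x \<longleftrightarrow> (\<exists>U. openin (Rn N) U \<and> x \<in> U \<and> (\<forall>y\<in>U \<inter> \<Omega>. f y \<le> f x))"

definition viscosity_subsolution ::
  "nat \<Rightarrow> nat \<Rightarrow> real \<Rightarrow> real \<Rightarrow> (nat \<Rightarrow> real) set \<Rightarrow> ((nat \<Rightarrow> real) \<Rightarrow> real) \<Rightarrow> bool" where
  "viscosity_subsolution N i p C \<Omega> u \<longleftrightarrow>
     usc_on N \<Omega> u \<and>
     (\<forall>\<phi> x. C2_on N \<Omega> \<phi> \<longrightarrow> x \<in> \<Omega> \<longrightarrow> local_max_at N \<Omega> (\<lambda>y. u y - \<phi> y) x \<longrightarrow>
        - eigval i (hessian N \<phi> x) + enorm N (gradient N \<phi> x) powr p \<le> C)"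

end

theory Submission
  imports Defs
begin

text \<open>
  Write \<open>u x = v \<bar>x\<bar>\<close>. The idea is to compare \<open>v\<close> on an interval around a radius \<open>\<rho>\<close> with the cone
  \<open>v \<rho> + L * \<bar>r - \<rho>\<bar>\<close>. If the cone lies above \<open>v\<close> at both ends of the interval but not everywhere
  inside, then \<open>v\<close> minus the cone attains its maximum at an interior radius \<open>r \<noteq> \<rho>\<close>
  (\<open>usc_attains_max\<close>, \<open>usc_le_cone\<close>). Near that radius the cone is \<open>\<plusminus>L * r\<close> up to a constant, so the
  function \<open>\<plusminus>L * \<bar>x\<bar>\<close>, which is smooth away from the origin, touches \<open>u\<close> from above. Its gradient has
  length \<open>L\<close>, and its Hessian has the eigenvalues \<open>0\<close> (in the radial direction) and \<open>\<plusminus>L / r\<close> (in the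
  tangential ones), so that the equation gives \<open>L powr p \<le> C + L / r\<close>, whatever the index \<open>i\<close>
  (\<open>subsolution_slope_bound\<close>). As \<open>p > 1\<close> and \<open>r\<close> is bounded below, this fails for large \<open>L\<close>.

  Radiality is what makes this work for every \<open>i\<close>: a cone with its vertex at a point other than the
  origin has tangential eigenvalues that blow up near the vertex, while the eigenvalues here are
  controlled by the distance to the origin. Since the origin is outside \<open>\<omega>'\<close>, that distance is at
  least \<open>d = dist \<omega> (\<partial>\<omega>')\<close> on \<open>\<omega>\<close>, and the same \<open>d\<close> gives room for the interval
  (\<open>eball_set_dist_frontier_subset\<close>).

  It remains to put the cone above \<open>v\<close> at the ends of the interval, knowing only that \<open>\<bar>u\<bar> \<le> M\<close>
  almost everywhere. The set where \<open>u < -M\<close> is open by semicontinuity and null, hence empty, so the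
  lower bound holds everywhere. An upper bound is needed at the two ends only, and these can be moved
  to radii with \<open>v \<le> M\<close>, because every shell has positive measure (\<open>open_AE_dense\<close>). Both bounds
  enter in \<open>one_sided_lipschitz\<close>, which then also bounds \<open>u\<close> from above on \<open>\<omega>\<close> and thereby treats
  pairs of points whose radii are far apart.
\<close>

section \<open>Euclidean distance and topology of the coordinate space\<close>

lemma L2_set_scale: "L2_set (\<lambda>j. c * f j) A = \<bar>c\<bar> * L2_set f A"
  by (simp add: L2_set_def power_mult_distrib sum_distrib_left[symmetric] real_sqrt_mult)

lemma enorm_nonneg [simp]: "0 \<le> enorm N x"
  by (simp add: enorm_def)

lemma edist_nonneg [simp]: "0 \<le> edist N x y"
  by (simp add: edist_def)

lemma edist_commute: "edist N x y = edist N y x"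
  unfolding edist_def L2_set_def by (simp add: power2_commute)

lemma edist_triangle: "edist N x z \<le> edist N x y + edist N y z"
  using L2_set_triangle_ineq[of "\<lambda>j. x j - y j" "\<lambda>j. y j - z j" "{..<N}"]
  by (simp add: edist_def)

lemma edist_origin: "edist N x (origin N) = enorm N x"
  unfolding edist_def enorm_def origin_def by (rule L2_set_cong) auto

lemma enorm_diff_le_edist: "\<bar>enorm N x - enorm N y\<bar> \<le> edist N x y"
  using edist_triangle[of N x "origin N" y] edist_triangle[of N y "origin N" x]
  by (simp add: edist_origin edist_commute)

lemma coord_le_edist: "j < N \<Longrightarrow> \<bar>x j - y j\<bar> \<le> edist N x y"
  unfolding edist_def using member_le_L2_set[of "{..<N}" j "\<lambda>j. \<bar>x j - y j\<bar>"]
  by (simp add: L2_set_def)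

lemma edist_self [simp]: "edist N x x = 0"
  by (simp add: edist_def L2_set_def)

lemma in_space_iff: "x \<in> topspace (Rn N) \<longleftrightarrow> x \<in> extensional {..<N}"
  by (simp add: PiE_def)

lemma enorm_pos_iff:
  assumes "x \<in> topspace (Rn N)"
  shows "0 < enorm N x \<longleftrightarrow> x \<noteq> origin N"
proof -
  have "enorm N x = 0 \<longleftrightarrow> (\<forall>j<N. x j = 0)"
    by (auto simp: enorm_def L2_set_eq_0_iff)
  also have "\<dots> \<longleftrightarrow> x = origin N"
    using assms unfolding in_space_iff origin_def
    by (auto simp: fun_eq_iff extensional_def)
  finally show ?thesis
    using enorm_nonneg[of N x] by linarith
qed

lemma mem_punctured_ball_iff:
  "x \<in> punctured_ball N R \<longleftrightarrow> x \<in> topspace (Rn N) \<and> 0 < enorm N x \<and> enorm N x < R"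
  unfolding punctured_ball_def using enorm_pos_iff by auto

lemma continuous_map_edist: "continuous_map (Rn N) euclideanreal (edist N x)"
  unfolding edist_def L2_set_def
  by (intro continuous_intros) auto

lemma continuous_map_enorm: "continuous_map (Rn N) euclideanreal (enorm N)"
  unfolding enorm_def L2_set_def
  by (intro continuous_intros) auto

lemma openin_eball: "openin (Rn N) {y \<in> topspace (Rn N). edist N x y < e}"
  using openin_continuous_map_preimage[OF continuous_map_edist[of N x], of "{..<e}"]
  by simp

lemma openin_shell: "openin (Rn N) {y \<in> topspace (Rn N). a < enorm N y \<and> enorm N y < b}"
  using openin_continuous_map_preimage[OF continuous_map_enorm[of N], of "{a<..<b}"]
  by simp

lemma openin_punctured_ball: "openin (Rn N) (punctured_ball N R)"
proof -
  have "punctured_ball N R = {y \<in> topspace (Rn N). 0 < enorm N y \<and> enorm N y < R}"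
    using mem_punctured_ball_iff by blast
  then show ?thesis
    using openin_shell[of N 0 R] by simp
qed

text \<open>
  Only finitely many coordinates occur, so the side lengths that the product topology gives for each
  coordinate have a positive minimum. Cubes serve twice: they have a computable measure, and they
  contain Euclidean balls.
\<close>

lemma openin_Rn_contains_box:
  assumes "openin (Rn N) U" "x \<in> U"
  obtains e where "e > 0" "(\<Pi>\<^sub>E j\<in>{..<N}. {x j - e..x j + e}) \<subseteq> U"
proof -
  obtain V where V: "\<And>j. j < N \<Longrightarrow> open (V j)" "x \<in> Pi\<^sub>E {..<N} V" "Pi\<^sub>E {..<N} V \<subseteq> U"
    using assms unfolding openin_product_topology_alt
    by (metis (no_types, lifting) open_openin lessThan_iff)
  have "\<exists>e>0. {x j - e..x j + e} \<subseteq> V j" if j: "j < N" for j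
  proof -
    have "x j \<in> V j" using V(2) j by auto
    then obtain e where "e > 0" "cball (x j) e \<subseteq> V j"
      using V(1)[OF j] open_contains_cball by blast
    then show ?thesis by (auto simp: cball_eq_atLeastAtMost)
  qed
  then obtain e where e: "\<And>j. j < N \<Longrightarrow> e j > 0" "\<And>j. j < N \<Longrightarrow> {x j - e j..x j + e j} \<subseteq> V j"
    by metis
  define m where "m = Min (insert 1 (e ` {..<N}))"
  have m: "m > 0" "\<And>j. j < N \<Longrightarrow> m \<le> e j"
    using e(1) by (auto simp: m_def)
  have "{x j - m..x j + m} \<subseteq> V j" if "j < N" for j
    using m(2)[OF that] e(2)[OF that] by force
  then have "(\<Pi>\<^sub>E j\<in>{..<N}. {x j - m..x j + m}) \<subseteq> Pi\<^sub>E {..<N} V"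
    by (intro PiE_mono) auto
  then show ?thesis
    using that[OF m(1)] V(3) by (meson subset_trans)
qed

lemma openin_Rn_contains_eball:
  assumes "openin (Rn N) U" "x \<in> U"
  obtains e where "e > 0" "{y \<in> topspace (Rn N). edist N x y < e} \<subseteq> U"
proof -
  obtain e where e: "e > 0" "(\<Pi>\<^sub>E j\<in>{..<N}. {x j - e..x j + e}) \<subseteq> U"
    using openin_Rn_contains_box[OF assms] .
  have "{y \<in> topspace (Rn N). edist N x y < e} \<subseteq> (\<Pi>\<^sub>E j\<in>{..<N}. {x j - e..x j + e})"
  proof
    fix y assume y: "y \<in> {y \<in> topspace (Rn N). edist N x y < e}"
    have "x j - e \<le> y j \<and> y j \<le> x j + e" if "j < N" for j
    proof -
      have "\<bar>x j - y j\<bar> < e"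
        using coord_le_edist[OF that, of x y] y by simp
      then show ?thesis by linarith
    qed
    then show "y \<in> (\<Pi>\<^sub>E j\<in>{..<N}. {x j - e..x j + e})"
      using y by (simp add: PiE_iff)
  qed
  then show ?thesis
    using that[OF e(1)] e(2) by (meson subset_trans)
qed

section \<open>Distance to the frontier\<close>

lemma compactin_finite_subcover:
  assumes "compactin X K" "\<And>x. x \<in> K \<Longrightarrow> openin X (U x)" "\<And>x. x \<in> K \<Longrightarrow> x \<in> U x"
  obtains T where "finite T" "T \<subseteq> K" "K \<subseteq> \<Union> (U ` T)"
proof -
  have "K \<subseteq> \<Union> (U ` K)"
    using assms(3) by blast
  then obtain \<F> where "finite \<F>" "\<F> \<subseteq> U ` K" "K \<subseteq> \<Union> \<F>"
    using compactinD[OF assms(1), of "U ` K"] assms(2) by auto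
  then show ?thesis
    using that finite_subset_image[of \<F> U K] by metis
qed

text \<open>
  The segment from \<open>x\<close> to \<open>z\<close> is connected, and all its points are at distance at most
  \<open>edist N x z\<close> from \<open>x\<close>.
\<close>

lemma segment_meets_frontier:
  assumes x: "x \<in> topspace (Rn N)" "x \<in> S" and z: "z \<in> topspace (Rn N)" "z \<notin> S"
  obtains y where "y \<in> Rn N frontier_of S" "edist N x y \<le> edist N x z"
proof -
  define g where "g = (\<lambda>t::real. \<lambda>j\<in>{..<N}. x j + t * (z j - x j))"
  have "continuous_map euclideanreal (Rn N) g"
    unfolding g_def continuous_map_componentwise
    by (auto intro!: continuous_intros)
  then have "connectedin (Rn N) (g ` {0..1})"
    by (rule connectedin_continuous_map_image) (simp add: connectedin_iff_connected)
  moreover have "g 0 = x" "g 1 = z"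
    using x z unfolding in_space_iff g_def by (auto simp: fun_eq_iff extensional_def)
  then have "x \<in> g ` {0..1}" "z \<in> g ` {0..1}"
    by force+
  then have "g ` {0..1} \<inter> S \<noteq> {}" "g ` {0..1} - S \<noteq> {}"
    using x z by blast+
  ultimately obtain t where t: "0 \<le> t" "t \<le> 1" "g t \<in> Rn N frontier_of S"
    using connectedin_Int_frontier_of[of "Rn N" "g ` {0..1}" S] by auto
  have "edist N x (g t) = L2_set (\<lambda>j. t * (x j - z j)) {..<N}"
    unfolding edist_def g_def
    by (simp add: L2_set_def power2_eq_square algebra_simps)
  also have "\<dots> = t * edist N x z"
    using t by (simp add: L2_set_scale edist_def)
  also have "\<dots> \<le> 1 * edist N x z"
    by (intro mult_right_mono t) (simp add: edist_def)
  finally show ?thesis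
    using that t(3) by simp
qed

lemma set_dist_le:
  assumes "x \<in> A" "y \<in> B"
  shows "set_dist N A B \<le> edist N x y"
  unfolding set_dist_def
  using assms by (intro cInf_lower bdd_belowI[of _ 0]) auto

text \<open>
  A nonempty bounded set has a frontier point on any segment that leaves it. Without such a point
  \<open>set_dist\<close> would be the infimum of the empty set.
\<close>

lemma frontier_nonempty:
  assumes "0 < N" "x \<in> S" "S \<subseteq> punctured_ball N R"
  shows "Rn N frontier_of S \<noteq> {}"
proof -
  define z where "z = (\<lambda>j\<in>{..<N}. R)"
  have "\<bar>R\<bar> \<le> enorm N z"
    using coord_le_edist[of 0 N z "origin N"] assms(1)
    unfolding edist_origin by (simp add: z_def origin_def)
  then have "z \<notin> S"
    using assms(3) mem_punctured_ball_iff by force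
  moreover have "z \<in> topspace (Rn N)"
    by (simp add: z_def)
  moreover have "x \<in> topspace (Rn N)"
    using assms mem_punctured_ball_iff by blast
  ultimately show ?thesis
    using segment_meets_frontier[of x N S z] assms(2) by auto
qed

text \<open>
  The closure of \<open>A\<close> is covered by finitely many balls whose doubles stay in \<open>S\<close>. A frontier point of
  \<open>S\<close> lies outside \<open>S\<close>, hence outside the doubled balls, and so the smallest of the radii separates it
  from \<open>A\<close>.
\<close>

lemma set_dist_frontier_pos:
  assumes "openin (Rn N) S" "compactly_contained N A S" "A \<subseteq> topspace (Rn N)"
    and "A \<noteq> {}" "Rn N frontier_of S \<noteq> {}"
  shows "0 < set_dist N A (Rn N frontier_of S)"
proof -
  let ?K = "Rn N closure_of A"
  have K: "compactin (Rn N) ?K" "?K \<subseteq> S"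
    using assms(2) by (auto simp: compactly_contained_def)
  define B where "B = (\<lambda>x e. {y \<in> topspace (Rn N). edist N x y < e})"
  have "\<exists>e>0. B x (2 * e) \<subseteq> S" if x: "x \<in> ?K" for x
  proof -
    obtain e where "e > 0" "B x e \<subseteq> S"
      using openin_Rn_contains_eball[OF assms(1)] K(2) x unfolding B_def by blast
    then show ?thesis
      by (intro exI[of _ "e/2"]) auto
  qed
  then obtain e where e: "\<And>x. x \<in> ?K \<Longrightarrow> 0 < e x" "\<And>x. x \<in> ?K \<Longrightarrow> B x (2 * e x) \<subseteq> S"
    by metis
  have "x \<in> B x (e x)" if "x \<in> ?K" for x
    using that e(1) closure_of_subset_topspace[of "Rn N" A] by (auto simp: B_def)
  moreover have "openin (Rn N) (B x (e x))" for x
    unfolding B_def by (rule openin_eball)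
  ultimately obtain T where T: "finite T" "T \<subseteq> ?K" "?K \<subseteq> (\<Union>x\<in>T. B x (e x))"
    using compactin_finite_subcover[OF K(1), of "\<lambda>x. B x (e x)"] by metis
  define m where "m = Min (insert 1 (e ` T))"
  have m: "m > 0" "\<And>x. x \<in> T \<Longrightarrow> m \<le> e x"
    using T(1,2) e(1) by (auto simp: m_def)
  have "m \<le> edist N z y" if zy: "z \<in> A" "y \<in> Rn N frontier_of S" for z y
  proof (rule ccontr)
    assume "\<not> m \<le> edist N z y"
    have "z \<in> ?K"
      using closure_of_subset[OF assms(3)] zy by blast
    then obtain x where x: "x \<in> T" "edist N x z < e x"
      using T(3) by (auto simp: B_def)
    have "edist N x y < 2 * e x"
      using edist_triangle[of N x y z] x m(2)[OF x(1)] \<open>\<not> m \<le> edist N z y\<close> by linarith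
    moreover have "y \<in> topspace (Rn N)" "y \<notin> S"
      using zy(2) openin_Int_closure_of_eq_empty assms(1)
      by (auto simp: frontier_of_def interior_of_openin closure_of_def)
    ultimately show False
      using e(2)[of x] x(1) T(2) by (auto simp: B_def)
  qed
  then have "m \<le> set_dist N A (Rn N frontier_of S)"
    unfolding set_dist_def using assms(4,5) by (intro cInf_greatest) auto
  with m(1) show ?thesis by linarith
qed

lemma eball_set_dist_frontier_subset:
  assumes "x \<in> A" "x \<in> S" "A \<subseteq> topspace (Rn N)" "z \<in> topspace (Rn N)"
    and "edist N x z < set_dist N A (Rn N frontier_of S)"
  shows "z \<in> S"
proof (rule ccontr)
  assume "z \<notin> S"
  then obtain y where "y \<in> Rn N frontier_of S" "edist N x y \<le> edist N x z"
    using segment_meets_frontier[of x N S z] assms by blast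
  then show False
    using set_dist_le[of x A y "Rn N frontier_of S" N] assms by linarith
qed

text \<open>
  Moving \<open>x\<close> along its own ray reaches the sphere of radius \<open>r\<close> by the shortest way. Hence a ball
  around \<open>x\<close> meets all spheres whose radius differs from that of \<open>x\<close> by less than the radius of the
  ball, which turns statements about balls into statements about intervals of radii.
\<close>

lemma radius_in_eball:
  assumes x: "x \<in> topspace (Rn N)" "0 < enorm N x" and "0 \<le> r"
  obtains z where "z \<in> topspace (Rn N)" "enorm N z = r" "edist N x z = \<bar>r - enorm N x\<bar>"
proof -
  define c where "c = r / enorm N x"
  define z where "z = (\<lambda>j\<in>{..<N}. c * x j)"
  have "enorm N z = L2_set (\<lambda>j. c * x j) {..<N}"
    unfolding enorm_def z_def by (intro L2_set_cong) auto
  also have "\<dots> = r"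
    using assms unfolding L2_set_scale by (simp add: c_def flip: enorm_def)
  finally have 1: "enorm N z = r" .
  have "edist N x z = L2_set (\<lambda>j. (1 - c) * x j) {..<N}"
    unfolding edist_def z_def by (intro L2_set_cong) (auto simp: algebra_simps)
  also have "\<dots> = \<bar>(1 - c) * enorm N x\<bar>"
    using x unfolding L2_set_scale by (simp add: abs_mult flip: enorm_def)
  also have "(1 - c) * enorm N x = enorm N x - r"
    using x(2) by (simp add: c_def field_simps)
  finally have "edist N x z = \<bar>r - enorm N x\<bar>"
    by simp
  then show ?thesis
    using that[of z] 1 by (auto simp: z_def)
qed

section \<open>Essential bounds\<close>

text \<open>
  A nonempty open set contains a cube, which has positive measure, so it meets every set of full
  measure.
\<close>

lemma open_AE_dense:
  assumes "openin (Rn N) U" "x \<in> U" "AE x in lebesgue_Rn N. P x"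
  shows "\<exists>y\<in>U. P y"
proof (rule ccontr)
  assume none: "\<not> (\<exists>y\<in>U. P y)"
  obtain e where e: "e > 0" "(\<Pi>\<^sub>E j\<in>{..<N}. {x j - e..x j + e}) \<subseteq> U"
    using openin_Rn_contains_box[OF assms(1,2)] .
  let ?B = "\<Pi>\<^sub>E j\<in>{..<N}. {x j - e..x j + e}"
  obtain Z where Z: "{x \<in> space (lebesgue_Rn N). \<not> P x} \<subseteq> Z" "emeasure (lebesgue_Rn N) Z = 0"
      "Z \<in> sets (lebesgue_Rn N)"
    using assms(3) by (rule AE_E)
  interpret product_sigma_finite "\<lambda>_::nat. lborel :: real measure" ..
  have "emeasure (lebesgue_Rn N) ?B = (\<Prod>j<N. ennreal (2 * e))"
    using e(1) by (subst emeasure_PiM) (auto intro!: prod.cong)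
  moreover have "?B \<subseteq> Z"
    using e none Z(1) by (auto simp: space_PiM)
  then have "emeasure (lebesgue_Rn N) ?B = 0"
    using Z(2,3) emeasure_mono[of ?B Z "lebesgue_Rn N"] by simp
  ultimately have "ennreal ((2*e) ^ N) = 0"
    using e(1) by (simp add: ennreal_power)
  then show False
    using e(1) by simp
qed

lemma locally_bounded_on_imp_bounded:
  assumes "locally_bounded_on N \<Omega> u" "compactin (Rn N) K" "K \<subseteq> \<Omega>"
  shows "bounded (u ` K)"
proof -
  obtain U where U: "\<And>x. x \<in> \<Omega> \<Longrightarrow> openin (Rn N) (U x) \<and> x \<in> U x \<and> bounded (u ` (U x \<inter> \<Omega>))"
    using assms(1) unfolding locally_bounded_on_def by metis
  obtain T where T: "finite T" "T \<subseteq> K" "K \<subseteq> \<Union> (U ` T)"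
    using compactin_finite_subcover[OF assms(2), of U] U assms(3) by (metis subsetD)
  have "bounded (\<Union>x\<in>T. u ` (U x \<inter> \<Omega>))"
    using T U assms(3) by (intro bounded_UN) blast+
  moreover have "u ` K \<subseteq> (\<Union>x\<in>T. u ` (U x \<inter> \<Omega>))"
    using T(3) assms(3) by blast
  ultimately show ?thesis
    using bounded_subset by blast
qed

text \<open>
  The infimum that defines \<open>Linf_norm\<close> is meaningful because a bounded function has an essential
  bound. The slack \<open>\<epsilon>\<close> avoids the question whether the infimum is attained.
\<close>

lemma Linf_norm_AE_bound:
  assumes "bounded (u ` S)" and "0 < \<epsilon>"
  obtains m where "0 \<le> m" "m < Linf_norm N S u + \<epsilon>" "AE x in lebesgue_Rn N. x \<in> S \<longrightarrow> \<bar>u x\<bar> \<le> m"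
proof -
  let ?B = "{M. 0 \<le> M \<and> (AE x in lebesgue_Rn N. x \<in> S \<longrightarrow> \<bar>u x\<bar> \<le> M)}"
  obtain b where "\<And>x. x \<in> S \<Longrightarrow> \<bar>u x\<bar> \<le> b"
    using assms(1) by (auto simp: bounded_iff)
  then have "max 0 b \<in> ?B"
    by (force intro!: AE_I2)
  then have "?B \<noteq> {}" by blast
  then have "\<exists>m\<in>?B. m < Linf_norm N S u + \<epsilon>"
    using assms(2) unfolding Linf_norm_def by (intro cInf_lessD) auto
  then show ?thesis
    using that by blast
qed

section \<open>The norm as a test function\<close>

text \<open>
  Along one coordinate the norm is the function \<open>sqrt (t\<^sup>2 + c)\<close>, which makes its partial derivatives a
  calculation in one variable.
\<close>

lemma enorm_fun_upd:
  assumes "j < N"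
  shows "enorm N (x(j := t)) = sqrt (t\<^sup>2 + (\<Sum>k\<in>{..<N} - {j}. (x k)\<^sup>2))"
proof -
  have "(\<Sum>k<N. ((x(j := t)) k)\<^sup>2) = t\<^sup>2 + (\<Sum>k\<in>{..<N} - {j}. ((x(j := t)) k)\<^sup>2)"
    using assms by (subst sum.remove[of _ j]) auto
  then show ?thesis
    unfolding enorm_def L2_set_def by simp
qed

lemma enorm_has_partial_derivative:
  assumes "j < N" "0 < enorm N x"
  shows "((\<lambda>t. enorm N (x(j := t))) has_field_derivative x j / enorm N x) (at (x j))"
proof -
  define c where "c = (\<Sum>k\<in>{..<N} - {j}. (x k)\<^sup>2)"
  have f: "(\<lambda>t. enorm N (x(j := t))) = (\<lambda>t. sqrt (t\<^sup>2 + c))"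
    using enorm_fun_upd[OF assms(1)] by (simp add: c_def)
  have e: "enorm N x = sqrt ((x j)\<^sup>2 + c)"
    using fun_cong[OF f, of "x j"] by simp
  then have "(x j)\<^sup>2 + c > 0"
    using assms(2) by simp
  then show ?thesis
    unfolding f e
    by (auto intro!: derivative_eq_intros simp: field_simps)
qed

lemma unit_coord_has_partial_derivative:
  assumes "k < N" "0 < enorm N x"
  shows "((\<lambda>t. (x(k := t)) j / enorm N (x(k := t))) has_field_derivative
          of_bool (j = k) / enorm N x - x j * x k / enorm N x ^ 3) (at (x k))"
proof -
  have 1: "((\<lambda>t. (x(k := t)) j) has_field_derivative of_bool (j = k)) (at (x k))"
    by (cases "j = k") (auto intro!: derivative_eq_intros)
  show ?thesis
    by (rule DERIV_cong[OF DERIV_divide[OF 1 enorm_has_partial_derivative[OF assms]]])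
       (use assms(2) in \<open>simp_all add: field_simps power2_eq_square power3_eq_cube\<close>)
qed

lemma partial_scaled_enorm:
  assumes "j < N" "0 < enorm N x"
  shows "partial j (\<lambda>x. s * enorm N x) x = s * (x j / enorm N x)"
  unfolding partial_def
  by (intro DERIV_imp_deriv DERIV_cmult enorm_has_partial_derivative assms)

text \<open>
  \<open>partial\<close> is given by a choice operator, so its formula is known only where the norm is positive. This
  suffices for the second derivative, since the norm stays positive in a neighbourhood of \<open>x k\<close> on the
  coordinate line.
\<close>

lemma partial_scaled_enorm_has_partial_derivative:
  assumes "j < N" "k < N" "0 < enorm N x"
  shows "((\<lambda>t. partial j (\<lambda>x. s * enorm N x) (x(k := t))) has_field_derivative
          s * (of_bool (j = k) / enorm N x - x j * x k / enorm N x ^ 3)) (at (x k))"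
proof -
  define S where "S = {t. 0 < enorm N (x(k := t))}"
  show ?thesis
  proof (rule has_field_derivative_transform_within_open)
    show "((\<lambda>t. s * ((x(k := t)) j / enorm N (x(k := t)))) has_field_derivative
        s * (of_bool (j = k) / enorm N x - x j * x k / enorm N x ^ 3)) (at (x k))"
      by (rule DERIV_cmult[OF unit_coord_has_partial_derivative[OF assms(2,3)]])
    show "open S"
      unfolding S_def enorm_fun_upd[OF assms(2)]
      by (intro open_Collect_less continuous_intros)
    show "x k \<in> S"
      using assms(3) by (simp add: S_def)
    show "s * ((x(k := t)) j / enorm N (x(k := t))) = partial j (\<lambda>x. s * enorm N x) (x(k := t))"
      if "t \<in> S" for t
      using partial_scaled_enorm[OF assms(1), of "x(k := t)" s] that by (simp add: S_def)
  qed
qed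

lemma partial_partial_scaled_enorm:
  assumes "j < N" "k < N" "0 < enorm N x"
  shows "partial k (partial j (\<lambda>x. s * enorm N x)) x =
           s * (of_bool (j = k) / enorm N x - x j * x k / enorm N x ^ 3)"
  unfolding partial_def[of k]
  by (intro DERIV_imp_deriv partial_scaled_enorm_has_partial_derivative assms)

lemma C2_on_scaled_enorm: "C2_on N (punctured_ball N R) (\<lambda>x. s * enorm N x)"
proof -
  let ?\<Omega> = "punctured_ball N R" and ?\<phi> = "\<lambda>x. s * enorm N x"
  let ?T = "subtopology (Rn N) ?\<Omega>"
  have pos: "0 < enorm N x" if "x \<in> ?\<Omega>" for x
    using that mem_punctured_ball_iff by blast
  have ne: "enorm N x \<noteq> 0" if "x \<in> topspace ?T" for x
    using that pos[of x] by auto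
  have n: "continuous_map ?T euclideanreal (enorm N)"
    using continuous_map_enorm continuous_map_from_subtopology by blast
  have c: "continuous_map ?T euclideanreal (\<lambda>x. x j)" if "j < N" for j
    using that by (intro continuous_map_from_subtopology continuous_map_product_projection) simp
  have "continuous_map ?T euclideanreal ?\<phi>"
    by (intro continuous_intros n)
  moreover have "has_partial_on j ?\<phi> ?\<Omega>" if "j < N" for j
    unfolding has_partial_on_def field_differentiable_def
    using DERIV_cmult[OF enorm_has_partial_derivative[OF that pos]] by blast
  moreover have "continuous_map ?T euclideanreal (partial j ?\<phi>)" if "j < N" for j
  proof (rule continuous_map_eq)
    show "continuous_map ?T euclideanreal (\<lambda>x. s * (x j / enorm N x))"
      by (intro continuous_intros n c that ne)
  qed (use partial_scaled_enorm[OF that pos] in auto)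
  moreover have "has_partial_on k (partial j ?\<phi>) ?\<Omega>" if "j < N" "k < N" for j k
    unfolding has_partial_on_def field_differentiable_def
    using partial_scaled_enorm_has_partial_derivative[OF that pos] by blast
  moreover have "continuous_map ?T euclideanreal (partial k (partial j ?\<phi>))" if "j < N" "k < N" for j k
  proof (rule continuous_map_eq)
    show "continuous_map ?T euclideanreal
            (\<lambda>x. s * (of_bool (j = k) / enorm N x - x j * x k / enorm N x ^ 3))"
      by (intro continuous_intros n c that) (use ne in auto)
  qed (use partial_partial_scaled_enorm[OF that pos] in auto)
  ultimately show ?thesis
    unfolding C2_on_def by blast
qed

section \<open>The Hessian at a point of the first coordinate axis\<close>

text \<open>
  A representative of the sphere of radius \<open>r\<close> at which the Hessian of the norm is diagonal; for a
  radial function it is as good as any other point of that sphere.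
\<close>

definition axis_point :: "nat \<Rightarrow> real \<Rightarrow> nat \<Rightarrow> real" where
  "axis_point N r = (\<lambda>j\<in>{..<N}. if j = 0 then r else 0)"

lemma axis_point_in_space: "axis_point N r \<in> topspace (Rn N)"
  by (simp add: axis_point_def)

lemma enorm_axis_point:
  assumes "0 < N" "0 \<le> r"
  shows "enorm N (axis_point N r) = r"
proof -
  have "(\<Sum>j<N. (axis_point N r j)\<^sup>2) = (\<Sum>j<N. if j = 0 then r\<^sup>2 else 0)"
    by (intro sum.cong) (auto simp: axis_point_def)
  then show ?thesis
    using assms by (simp add: enorm_def L2_set_def)
qed

lemma axis_point_mem_punctured_ball:
  assumes "0 < N" "0 < r" "r < R"
  shows "axis_point N r \<in> punctured_ball N R"
  using assms axis_point_in_space[of N r] enorm_axis_point[of N r]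
  unfolding mem_punctured_ball_iff by simp

lemma edist_axis_point:
  assumes "0 < N"
  shows "edist N (axis_point N r) (axis_point N r') = \<bar>r - r'\<bar>"
proof -
  have "edist N (axis_point N r) (axis_point N r') = enorm N (axis_point N \<bar>r - r'\<bar>)"
    unfolding edist_def enorm_def L2_set_def
    by (intro arg_cong[where f = sqrt] sum.cong) (auto simp: axis_point_def)
  then show ?thesis
    using assms by (simp add: enorm_axis_point)
qed

text \<open>
  For a triangular matrix the characteristic polynomial splits with the diagonal entries as its roots,
  so there are enough real roots for the \<open>i\<close>-th one to exist.
\<close>

lemma eigval_upper_triangular:
  assumes "X \<in> carrier_mat N N" "upper_triangular X" "i \<in> {1..N}"
  shows "eigval i X \<in> set (diag_mat X)"
proof -
  have "proots (char_poly X) = mset (diag_mat X)"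
  proof -
    have "proots (\<Prod>a\<leftarrow>xs. [:- a, 1:]) = mset xs" for xs :: "real list"
    proof (induction xs)
      case (Cons a xs)
      have "(\<Prod>a\<leftarrow>xs. [:- a, 1:]) \<noteq> 0"
        by (auto simp: prod_list_zero_iff)
      then show ?case
        using Cons.IH proots_mult[of "[:- a, 1:]" "\<Prod>a\<leftarrow>xs. [:- a, 1:]"]
        by (simp del: mult_pCons_left)
    qed simp
    then show ?thesis
      by (simp add: char_poly_upper_triangular[OF assms(1,2)])
  qed
  then have "eigval i X = sort (diag_mat X) ! (i - 1)"
    unfolding eigval_def by (simp only: sorted_list_of_multiset_mset)
  moreover have "i - 1 < length (sort (diag_mat X))"
    using assms(1,3) by (auto simp: diag_mat_def)
  ultimately have "eigval i X \<in> set (sort (diag_mat X))"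
    by (simp only: nth_mem)
  then show ?thesis
    by simp
qed

text \<open>
  The Hessian is the diagonal matrix with \<open>0\<close> in the radial direction and \<open>s / r\<close> in all others.
\<close>

lemma eigval_hessian_scaled_enorm_axis_point:
  assumes "i \<in> {1..N}" "0 < r"
  shows "eigval i (hessian N (\<lambda>x. s * enorm N x) (axis_point N r)) \<le> max 0 (s / r)"
proof -
  let ?X = "hessian N (\<lambda>x. s * enorm N x) (axis_point N r)"
  have n: "enorm N (axis_point N r) = r"
    using assms by (intro enorm_axis_point) auto
  have X: "?X $$ (j, k) = (if j = k \<and> j \<noteq> 0 then s / r else 0)" if "j < N" "k < N" for j k
  proof -
    have "?X $$ (j, k) = s * (of_bool (k = j) / r - axis_point N r k * axis_point N r j / r ^ 3)"
      using that assms(2) partial_partial_scaled_enorm[of k N j "axis_point N r" s]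
      by (simp add: hessian_def n)
    then show ?thesis
      using that assms(2) by (auto simp: axis_point_def power3_eq_cube)
  qed
  have "?X \<in> carrier_mat N N"
    by (simp add: hessian_def)
  moreover have "upper_triangular ?X"
    using X by (auto simp: hessian_def)
  ultimately have "eigval i ?X \<in> set (diag_mat ?X)"
    using eigval_upper_triangular assms(1) by blast
  then obtain j where "j < N" "eigval i ?X = ?X $$ (j, j)"
    by (auto simp: diag_mat_def hessian_def)
  then show ?thesis
    using X by auto
qed

lemma enorm_gradient_scaled_enorm:
  assumes "0 < enorm N x"
  shows "enorm N (gradient N (\<lambda>x. s * enorm N x) x) = \<bar>s\<bar>"
proof -
  have "enorm N (gradient N (\<lambda>x. s * enorm N x) x) = L2_set (\<lambda>j. s / enorm N x * x j) {..<N}"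
    unfolding gradient_def enorm_def[of N "restrict _ _"]
    by (intro L2_set_cong) (auto simp: partial_scaled_enorm[OF _ assms])
  also have "\<dots> = \<bar>s\<bar>"
    using assms unfolding L2_set_scale by (simp flip: enorm_def)
  finally show ?thesis .
qed

section \<open>Comparison of semicontinuous functions with cones\<close>

text \<open>
  Otherwise every \<open>x\<close> has a competitor \<open>g x\<close> with a larger value, and by semicontinuity the
  competitor also beats all points near \<open>x\<close>. Finitely many competitors then beat all points of \<open>K\<close>,
  which is absurd for the best among them.
\<close>

lemma usc_attains_max:
  fixes f :: "'a::metric_space \<Rightarrow> real"
  assumes "compact K" "K \<noteq> {}"
    and usc: "\<And>x c. x \<in> K \<Longrightarrow> f x < c \<Longrightarrow> \<exists>e>0. \<forall>y\<in>K. dist x y < e \<longrightarrow> f y < c"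
  obtains m where "m \<in> K" "\<And>y. y \<in> K \<Longrightarrow> f y \<le> f m"
proof -
  have "\<exists>m\<in>K. \<forall>y\<in>K. f y \<le> f m"
  proof (rule ccontr)
    assume "\<not> ?thesis"
    then obtain g where g: "\<And>x. x \<in> K \<Longrightarrow> g x \<in> K \<and> f x < f (g x)"
      by (metis not_le)
    then have "\<exists>e>0. \<forall>y\<in>K. dist x y < e \<longrightarrow> f y < f (g x)" if "x \<in> K" for x
      using usc that by blast
    then obtain e where e: "\<And>x. x \<in> K \<Longrightarrow> e x > 0"
        "\<And>x y. x \<in> K \<Longrightarrow> y \<in> K \<Longrightarrow> dist x y < e x \<Longrightarrow> f y < f (g x)"
      by metis
    have "K \<subseteq> (\<Union>x\<in>K. ball x (e x))"
      using e(1) by auto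
    then obtain T where T: "T \<subseteq> K" "finite T" "K \<subseteq> (\<Union>x\<in>T. ball x (e x))"
      using compactE_image[OF assms(1), of K "\<lambda>x. ball x (e x)"] by auto
    then have "T \<noteq> {}"
      using assms(2) by auto
    then have "Max ((\<lambda>x. f (g x)) ` T) \<in> (\<lambda>x. f (g x)) ` T"
      using T(2) by (intro Max_in) auto
    then obtain x where x: "x \<in> T" "f (g x) = Max ((\<lambda>x. f (g x)) ` T)"
      by auto
    have "g x \<in> K"
      using x T(1) g by blast
    then obtain z where z: "z \<in> T" "dist z (g x) < e z"
      using T(3) by auto
    then have "f (g x) < f (g z)"
      using e(2)[of z "g x"] \<open>g x \<in> K\<close> T(1) by blast
    moreover have "f (g z) \<le> f (g x)"
      unfolding x(2) using T(2) z(1) by (intro Max_ge) auto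
    ultimately show False
      by simp
  qed
  then show ?thesis
    using that by blast
qed

text \<open>
  The hypothesis \<open>slope\<close> is the viscosity inequality in the form in which it is needed: no line of
  slope \<open>L\<close> or \<open>- L\<close> touches \<open>v\<close> from above at an interior point. The vertex \<open>\<rho>\<close> of the cone cannot be
  the place where \<open>v\<close> exceeds the cone, and away from \<open>\<rho>\<close> the cone is such a line.
\<close>

lemma usc_le_cone:
  fixes v :: "real \<Rightarrow> real"
  assumes usc: "\<And>r c. r \<in> {a..b} \<Longrightarrow> v r < c \<Longrightarrow> \<exists>e>0. \<forall>t\<in>{a..b}. \<bar>r - t\<bar> < e \<longrightarrow> v t < c"
    and \<rho>: "a < \<rho>" "\<rho> < b"
    and ends: "v a \<le> v \<rho> + L * (\<rho> - a)" "v b \<le> v \<rho> + L * (b - \<rho>)"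
    and slope: "\<And>r s e. a < r \<Longrightarrow> r < b \<Longrightarrow> s = L \<or> s = - L \<Longrightarrow> 0 < e \<Longrightarrow>
       \<forall>t. \<bar>r - t\<bar> < e \<longrightarrow> v t - s * t \<le> v r - s * r \<Longrightarrow> False"
    and r: "r \<in> {a..b}"
  shows "v r \<le> v \<rho> + L * \<bar>r - \<rho>\<bar>"
proof -
  define f where "f = (\<lambda>t. v t - L * \<bar>t - \<rho>\<bar>)"
  have usc_f: "\<exists>e>0. \<forall>t\<in>{a..b}. dist r t < e \<longrightarrow> f t < c" if rc: "r \<in> {a..b}" "f r < c" for r c
  proof -
    define h where "h = (c - f r) / 2"
    have h: "h > 0"
      using rc(2) by (simp add: h_def)
    then obtain e where e: "e > 0" "\<And>t. t \<in> {a..b} \<Longrightarrow> \<bar>r - t\<bar> < e \<Longrightarrow> v t < v r + h"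
      using usc[OF rc(1), of "v r + h"] by auto
    have "isCont (\<lambda>t. L * \<bar>t - \<rho>\<bar>) r"
      by (intro continuous_intros)
    then obtain e' where e': "e' > 0"
        "\<And>t. dist t r < e' \<Longrightarrow> dist (L * \<bar>t - \<rho>\<bar>) (L * \<bar>r - \<rho>\<bar>) < h"
      using h unfolding continuous_at_eps_delta by blast
    have "f t < c" if "t \<in> {a..b}" "dist r t < min e e'" for t
    proof -
      have "v t < v r + h"
        using e(2) that by (simp add: dist_real_def)
      moreover have "\<bar>L * \<bar>t - \<rho>\<bar> - L * \<bar>r - \<rho>\<bar>\<bar> < h"
        using e'(2)[of t] that by (simp add: dist_real_def abs_minus_commute)
      ultimately show ?thesis
        unfolding f_def using h_def[unfolded f_def] by argo
    qed
    then show ?thesis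
      using e(1) e'(1) by (intro exI[of _ "min e e'"]) auto
  qed
  obtain m where m: "m \<in> {a..b}" "\<And>t. t \<in> {a..b} \<Longrightarrow> f t \<le> f m"
    using usc_attains_max[of "{a..b}" f] usc_f \<rho> by auto
  have "f m \<le> v \<rho>"
  proof (rule ccontr)
    assume "\<not> f m \<le> v \<rho>"
    then have "m \<noteq> \<rho>" "m \<noteq> a" "m \<noteq> b"
      using ends \<rho> by (auto simp: f_def)
    then have ab: "a < m" "m < b"
      using m(1) by auto
    \<comment> \<open>The slope of the branch of the cone that contains \<open>m\<close>.\<close>
    define s where "s = (if m < \<rho> then - L else L)"
    \<comment> \<open>Within this distance \<open>t\<close> stays in the interval and on the same side of the vertex as \<open>m\<close>.\<close>
    define e where "e = Min {m - a, b - m, \<bar>m - \<rho>\<bar>}"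
    have "e > 0"
      using ab \<open>m \<noteq> \<rho>\<close> by (auto simp: e_def)
    moreover have "v t - s * t \<le> v m - s * m" if "\<bar>m - t\<bar> < e" for t
    proof -
      have t: "t \<in> {a..b}" "\<bar>m - t\<bar> < \<bar>m - \<rho>\<bar>"
        using that unfolding e_def by auto
      have "s * (t - m) = L * \<bar>t - \<rho>\<bar> - L * \<bar>m - \<rho>\<bar>"
        using t(2) by (auto simp: s_def abs_if algebra_simps split: if_splits)
      then show ?thesis
        using m(2)[OF t(1)] by (simp add: f_def algebra_simps)
    qed
    ultimately show False
      using slope[OF ab _ \<open>e > 0\<close>, of s] by (metis s_def)
  qed
  then show ?thesis
    using m(2)[OF r] by (simp add: f_def)
qed

section \<open>Radial subsolutions in one variable\<close>

lemma radial_on_axis: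
  assumes "radial_on N (punctured_ball N R) u" "0 < N" "x \<in> punctured_ball N R"
  shows "u x = u (axis_point N (enorm N x))"
proof -
  have "0 < enorm N x" "enorm N x < R"
    using assms(3) by (simp_all add: mem_punctured_ball_iff)
  then have "axis_point N (enorm N x) \<in> punctured_ball N R"
    by (rule axis_point_mem_punctured_ball[OF assms(2)])
  moreover have "enorm N x = enorm N (axis_point N (enorm N x))"
    using enorm_axis_point[OF assms(2) enorm_nonneg] by (rule sym)
  ultimately show ?thesis
    using assms(1,3) unfolding radial_on_def by metis
qed

lemma usc_on_axis:
  assumes "usc_on N (punctured_ball N R) u" "0 < N" "0 < r" "r < R" "u (axis_point N r) < c"
  shows "\<exists>e>0. \<forall>t. \<bar>r - t\<bar> < e \<longrightarrow> u (axis_point N t) < c"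
proof -
  let ?S = "{x \<in> punctured_ball N R. u x < c}"
  have "openin (Rn N) ?S"
    using assms(1) openin_punctured_ball openin_trans_full unfolding usc_on_def by blast
  moreover have "axis_point N r \<in> ?S"
    using assms by (simp add: axis_point_mem_punctured_ball)
  ultimately obtain e where e: "e > 0"
      "{y \<in> topspace (Rn N). edist N (axis_point N r) y < e} \<subseteq> ?S"
    by (rule openin_Rn_contains_eball)
  have "u (axis_point N t) < c" if "\<bar>r - t\<bar> < e" for t
  proof -
    have "axis_point N t \<in> {y \<in> topspace (Rn N). edist N (axis_point N r) y < e}"
      using that edist_axis_point[OF assms(2), of r t] axis_point_in_space[of N t] by simp
    then have "axis_point N t \<in> ?S"
      by (rule subsetD[OF e(2)])
    then show ?thesis
      by simp
  qed
  with e(1) show ?thesis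
    by metis
qed

text \<open>
  If a line of slope \<open>s\<close> touches the radial profile from above, then \<open>s * \<bar>x\<bar>\<close> touches \<open>u\<close> from above
  on the whole sphere, and the equation can be evaluated at the point of the sphere on the first
  coordinate axis. The bound \<open>max 0 (s / r)\<close> for the eigenvalue covers every index \<open>i\<close>.
\<close>

lemma subsolution_slope_bound:
  assumes sub: "viscosity_subsolution N i p C (punctured_ball N R) u"
    and rad: "radial_on N (punctured_ball N R) u"
    and i: "i \<in> {1..N}" and r: "0 < r" "r < R" and "0 < e"
    and max: "\<And>t. 0 < t \<Longrightarrow> t < R \<Longrightarrow> \<bar>r - t\<bar> < e \<Longrightarrow>
        u (axis_point N t) - s * t \<le> u (axis_point N r) - s * r"
  shows "\<bar>s\<bar> powr p \<le> C + max 0 (s / r)"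
proof -
  let ?\<Omega> = "punctured_ball N R" and ?\<phi> = "\<lambda>x. s * enorm N x" and ?x = "axis_point N r"
  let ?U = "{y \<in> topspace (Rn N). r - e < enorm N y \<and> enorm N y < r + e}"
  have N: "0 < N"
    using i by auto
  have x: "?x \<in> ?\<Omega>" "enorm N ?x = r"
    using r N by (simp_all add: axis_point_mem_punctured_ball enorm_axis_point)
  have "local_max_at N ?\<Omega> (\<lambda>y. u y - ?\<phi> y) ?x"
    unfolding local_max_at_def
  proof (intro exI[of _ ?U] conjI ballI)
    show "openin (Rn N) ?U"
      by (rule openin_shell)
    show "?x \<in> ?U"
      using x(2) \<open>0 < e\<close> axis_point_in_space[of N r] by simp
    fix y assume y: "y \<in> ?U \<inter> ?\<Omega>"
    then have y\<Omega>: "y \<in> ?\<Omega>"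
      by (rule IntD2)
    have "r - e < enorm N y" "enorm N y < r + e"
      using y by simp_all
    then have t: "0 < enorm N y" "enorm N y < R" "\<bar>r - enorm N y\<bar> < e"
      using y\<Omega> by (simp_all add: mem_punctured_ball_iff abs_less_iff)
    moreover have "u y = u (axis_point N (enorm N y))"
      by (rule radial_on_axis[OF rad N y\<Omega>])
    ultimately show "u y - ?\<phi> y \<le> u ?x - ?\<phi> ?x"
      using max[of "enorm N y"] x(2) by simp
  qed
  then have "- eigval i (hessian N ?\<phi> ?x) + enorm N (gradient N ?\<phi> ?x) powr p \<le> C"
    using sub C2_on_scaled_enorm[of N R s] x(1) unfolding viscosity_subsolution_def by metis
  then show ?thesis
    using eigval_hessian_scaled_enorm_axis_point[OF i r(1), of s]
      enorm_gradient_scaled_enorm[of N ?x s] x(2) r(1) by simp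
qed

text \<open>
  The smallness condition on \<open>L / a\<close> excludes slopes \<open>L\<close> and \<open>- L\<close> at all radii beyond \<open>a\<close>, since the
  positive tangential eigenvalue \<open>L / r\<close> decreases with \<open>r\<close>.
\<close>

lemma profile_le_cone:
  assumes i: "i \<in> {1..N}"
    and usc: "usc_on N (punctured_ball N R) u" and rad: "radial_on N (punctured_ball N R) u"
    and sub: "viscosity_subsolution N i p C (punctured_ball N R) u"
    and L: "0 \<le> L" "C + L / a < L powr p"
    and ord: "0 < a" "a < \<rho>" "\<rho> < b" "b < R"
    and ends: "u (axis_point N a) \<le> u (axis_point N \<rho>) + L * (\<rho> - a)"
      "u (axis_point N b) \<le> u (axis_point N \<rho>) + L * (b - \<rho>)"
    and r: "r \<in> {a..b}"
  shows "u (axis_point N r) \<le> u (axis_point N \<rho>) + L * \<bar>r - \<rho>\<bar>"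
proof (rule usc_le_cone[where v = "\<lambda>t. u (axis_point N t)", OF _ ord(2,3) ends _ r])
  fix t c assume t: "t \<in> {a..b}" "u (axis_point N t) < c"
  then show "\<exists>e>0. \<forall>t'\<in>{a..b}. \<bar>t - t'\<bar> < e \<longrightarrow> u (axis_point N t') < c"
    using usc_on_axis[OF usc, of t c] i ord by auto
next
  fix t s e
  assume t: "a < t" "t < b" and s: "s = L \<or> s = - L" and "0 < (e::real)"
    and "\<forall>t'. \<bar>t - t'\<bar> < e \<longrightarrow> u (axis_point N t') - s * t' \<le> u (axis_point N t) - s * t"
  then have "\<bar>s\<bar> powr p \<le> C + max 0 (s / t)"
    using ord by (intro subsolution_slope_bound[OF sub rad i, of t e]) auto
  moreover have "max 0 (s / t) \<le> L / a"
  proof -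
    have "s / t \<le> L / t"
      using s L(1) ord t by (intro divide_right_mono) auto
    also have "\<dots> \<le> L / a"
      using L(1) ord t by (intro divide_left_mono mult_pos_pos) auto
    finally show ?thesis
      using L(1) ord by simp
  qed
  moreover have "\<bar>s\<bar> = L"
    using s L(1) by auto
  ultimately show False
    using L(2) by simp
qed

text \<open>
  The cone comparison is applied on an interval \<open>{a..b}\<close> around the radius of \<open>x\<close>, with the vertex at
  the radius of \<open>y\<close> if the two radii are close. Otherwise a vertex near the radius of \<open>x\<close> at which \<open>u\<close>
  is at most \<open>M\<close> yields an upper bound for \<open>u x\<close>, and \<open>L\<close> is so large that \<open>u x - u y\<close> is at most
  \<open>L\<close> times the difference of the radii. The bound \<open>M\<close> is assumed almost everywhere only, as this
  is all that the essential supremum gives.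
\<close>

lemma one_sided_lipschitz:
  assumes i: "i \<in> {1..N}"
    and usc: "usc_on N (punctured_ball N R) u" and rad: "radial_on N (punctured_ball N R) u"
    and sub: "viscosity_subsolution N i p C (punctured_ball N R) u"
    and S: "openin (Rn N) S" "S \<subseteq> punctured_ball N R"
    and bound: "AE x in lebesgue_Rn N. x \<in> S \<longrightarrow> \<bar>u x\<bar> \<le> M"
    and d: "0 < d" "d \<le> enorm N x" "{y \<in> topspace (Rn N). edist N x y < d} \<subseteq> S"
    and L: "0 \<le> L" "C + L / (d / 2) < L powr p" "2 * M \<le> L * (d / 16)"
    and x: "x \<in> S" and y: "y \<in> S"
  shows "u x - u y \<le> L * edist N x y"
proof -
  let ?v = "\<lambda>r. u (axis_point N r)" and ?r = "enorm N x"
  have N: "0 < N"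
    using i by auto
  have v: "u z = ?v (enorm N z)" if "z \<in> S" for z
    using radial_on_axis[OF rad N, of z] S(2) that by blast
  have ball: "\<exists>z\<in>S. enorm N z = r" if "\<bar>r - ?r\<bar> < d" for r
  proof -
    have xt: "x \<in> topspace (Rn N)" "0 < ?r"
      using x S(2) by (auto simp only: mem_punctured_ball_iff dest!: subsetD)
    have "0 \<le> r"
      using that d(2) by linarith
    then obtain z where z: "z \<in> topspace (Rn N)" "enorm N z = r" "edist N x z = \<bar>r - ?r\<bar>"
      by (rule radius_in_eball[OF xt])
    then have "z \<in> S"
      using that by (intro subsetD[OF d(3)]) simp
    then show ?thesis
      using z(2) by blast
  qed
  have range: "0 < r \<and> r < R" if "\<bar>r - ?r\<bar> < d" for r
    using ball[OF that] S(2) mem_punctured_ball_iff by blast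
  have good: "\<exists>r. a < r \<and> r < b \<and> ?v r \<le> M" if ab: "a < b" "?r - d < a" "b < ?r + d" for a b
  proof -
    let ?U = "{z \<in> topspace (Rn N). a < enorm N z \<and> enorm N z < b} \<inter> S"
    have "\<bar>(a + b) / 2 - ?r\<bar> < d"
      using ab by argo
    then obtain z where z: "z \<in> S" "enorm N z = (a + b) / 2"
      using ball by blast
    moreover have "z \<in> topspace (Rn N)"
      using subsetD[OF openin_subset[OF S(1)] z(1)] .
    ultimately have "z \<in> ?U"
      using ab(1) by simp
    moreover have "openin (Rn N) ?U"
      using openin_shell S(1) by blast
    ultimately obtain w where w: "w \<in> ?U" "w \<in> S \<longrightarrow> \<bar>u w\<bar> \<le> M"
      using open_AE_dense[OF _ _ bound] by blast
    then show ?thesis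
      using v[of w] by (intro exI[of _ "enorm N w"]) auto
  qed
  have lower: "- M \<le> u z" if "z \<in> S" for z
  proof (rule ccontr)
    assume "\<not> - M \<le> u z"
    let ?U = "{z \<in> punctured_ball N R. u z < - M} \<inter> S"
    have "openin (Rn N) ?U"
      using usc S(1) openin_punctured_ball openin_trans_full unfolding usc_on_def by blast
    moreover have "z \<in> ?U"
      using that S(2) \<open>\<not> - M \<le> u z\<close> by auto
    ultimately obtain w where "w \<in> ?U" "w \<in> S \<longrightarrow> \<bar>u w\<bar> \<le> M"
      using open_AE_dense[OF _ _ bound] by blast
    then show False
      by auto
  qed
  have lower_v: "- M \<le> ?v r" if "\<bar>r - ?r\<bar> < d" for r
    using ball[OF that] lower v by force
  \<comment> \<open>The interval \<open>{a..b}\<close> keeps distance \<open>d / 2\<close> from radius \<open>0\<close>, and every vertex within \<open>d / 8\<close>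
     of the radius of \<open>x\<close> is at least \<open>d / 8\<close> away from both ends.\<close>
  obtain a where a: "?r - d / 2 < a" "a < ?r - d / 4" "?v a \<le> M"
    using good[of "?r - d / 2" "?r - d / 4"] d(1) by auto
  obtain b where b: "?r + d / 4 < b" "b < ?r + d / 2" "?v b \<le> M"
    using good[of "?r + d / 4" "?r + d / 2"] d(1) by auto
  have cone: "u x \<le> ?v \<rho> + L * \<bar>?r - \<rho>\<bar>" if \<rho>: "\<bar>\<rho> - ?r\<bar> \<le> d / 8" for \<rho>
  proof -
    have gap: "d / 16 \<le> \<rho> - a" "d / 16 \<le> b - \<rho>"
      using \<rho> a b d(1) by linarith+
    then have "2 * M \<le> L * (\<rho> - a)" "2 * M \<le> L * (b - \<rho>)"
      by (simp_all add: order.trans[OF L(3) mult_left_mono[OF _ L(1)]])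
    moreover have "- M \<le> ?v \<rho>"
      using lower_v \<rho> d(1) by simp
    ultimately have ends: "?v a \<le> ?v \<rho> + L * (\<rho> - a)" "?v b \<le> ?v \<rho> + L * (b - \<rho>)"
      using a(3) b(3) by linarith+
    have "L / a \<le> L / (d / 2)"
      using L(1) a(1) d(1,2) by (intro divide_left_mono mult_pos_pos) auto
    then have slope: "C + L / a < L powr p"
      using L(2) by linarith
    have "0 < a" "a < \<rho>" "\<rho> < b" "b < R" "?r \<in> {a..b}"
      using a b d gap range[of b] by auto
    then have "?v ?r \<le> ?v \<rho> + L * \<bar>?r - \<rho>\<bar>"
      by (intro profile_le_cone[OF i usc rad sub L(1) slope _ _ _ _ ends])
    then show ?thesis
      using v[OF x] by simp
  qed
  have "u x - u y \<le> L * \<bar>?r - enorm N y\<bar>"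
  proof (cases "\<bar>enorm N y - ?r\<bar> \<le> d / 8")
    case True
    then show ?thesis
      using cone[OF True] v[OF y] by simp
  next
    case False
    obtain \<rho> where \<rho>: "?r - d / 16 < \<rho>" "\<rho> < ?r + d / 16" "?v \<rho> \<le> M"
      using good[of "?r - d / 16" "?r + d / 16"] d(1) by auto
    have "u x \<le> ?v \<rho> + L * \<bar>?r - \<rho>\<bar>"
      using \<rho> by (intro cone) linarith
    also have "L * \<bar>?r - \<rho>\<bar> \<le> L * (d / 16)"
    proof (rule mult_left_mono[OF _ L(1)])
      show "\<bar>?r - \<rho>\<bar> \<le> d / 16"
        using \<rho>(1,2) by linarith
    qed
    finally have "u x - u y \<le> L * (d / 8)"
      using \<rho>(3) lower[OF y] L(3) by linarith
    also have "\<dots> \<le> L * \<bar>?r - enorm N y\<bar>"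
    proof (rule mult_left_mono[OF _ L(1)])
      show "d / 8 \<le> \<bar>?r - enorm N y\<bar>"
        using False by linarith
    qed
    finally show ?thesis .
  qed
  also have "\<dots> \<le> L * edist N x y"
    using L(1) enorm_diff_le_edist by (intro mult_left_mono)
  finally show ?thesis .
qed

section \<open>The Lipschitz constant\<close>

text \<open>
  The second summand makes \<open>L powr (p - 1)\<close> exceed \<open>C + 2 / d\<close>, which rules out slopes \<open>\<plusminus>L\<close> at
  radii of at least \<open>d / 2\<close>; the third lets cones of slope \<open>L\<close> rise by \<open>2 * (M + 1)\<close> within the
  distance \<open>d / 16\<close>, where \<open>M + 1\<close> is an essential bound even if the infimum \<open>M\<close> is not known to be
  one. The summand \<open>1\<close> gives \<open>L \<ge> 1\<close>, so that \<open>C \<le> C * L\<close>. With the absolute values it also makes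
  the constant positive for empty sets, whose distance is an unspecified number.
\<close>

definition lipschitz_const :: "real \<Rightarrow> real \<Rightarrow> real \<Rightarrow> real \<Rightarrow> real" where
  "lipschitz_const p C d M = 1 + (C + 2 / \<bar>d\<bar>) powr (1 / (p - 1)) + 32 * (\<bar>M\<bar> + 1) / \<bar>d\<bar>"

lemma lipschitz_const_ge_1: "1 \<le> lipschitz_const p C d M"
  by (simp add: lipschitz_const_def)

lemma lipschitz_const_powr:
  assumes "1 < p" "0 \<le> C" "0 < d"
  shows "C + lipschitz_const p C d M / (d / 2) < lipschitz_const p C d M powr p"
proof -
  define L where "L = lipschitz_const p C d M"
  define k where "k = C + 2 / d"
  have k: "0 < k"
    using assms by (simp add: k_def add_nonneg_pos)
  have L: "1 \<le> L"
    unfolding L_def by (rule lipschitz_const_ge_1)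
  have "k powr (1 / (p - 1)) < L"
    using assms by (simp add: L_def lipschitz_const_def k_def add_pos_nonneg)
  then have "(k powr (1 / (p - 1))) powr (p - 1) < L powr (p - 1)"
    using assms by (intro powr_less_mono2) auto
  then have "k < L powr (p - 1)"
    using assms k by (simp add: powr_powr)
  then have "L * k < L * L powr (p - 1)"
    using L by simp
  also have "\<dots> = L powr p"
    using L powr_add[of L 1 "p - 1"] by simp
  also have "C + L / (d / 2) \<le> L * k"
    using mult_right_mono[OF L assms(2)] by (simp add: k_def algebra_simps)
  finally (xtrans) show ?thesis
    by (simp add: L_def)
qed

lemma lipschitz_const_oscillation:
  assumes "0 < d" "m \<le> M + 1"
  shows "2 * m \<le> lipschitz_const p C d M * (d / 16)"
proof -
  have "2 * m \<le> 2 * (\<bar>M\<bar> + 1)"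
    using assms(2) by simp
  also have "\<dots> = 32 * (\<bar>M\<bar> + 1) / \<bar>d\<bar> * (d / 16)"
    using assms(1) by (simp add: field_simps)
  also have "\<dots> \<le> lipschitz_const p C d M * (d / 16)"
    using assms(1) by (intro mult_right_mono) (auto simp: lipschitz_const_def)
  finally show ?thesis .
qed

section \<open>Interior Lipschitz estimate\<close>

text \<open>
  The origin is outside \<open>S\<close>, while the ball of radius \<open>d\<close> around \<open>x\<close> is inside. This both keeps the radii
  away from \<open>0\<close> and leaves room for the comparison interval.
\<close>

lemma interior_lipschitz:
  assumes i: "i \<in> {1..N}" and p: "1 < p" and C: "0 \<le> C"
    and usc: "usc_on N (punctured_ball N R) u" and rad: "radial_on N (punctured_ball N R) u"
    and bdd: "locally_bounded_on N (punctured_ball N R) u"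
    and sub: "viscosity_subsolution N i p C (punctured_ball N R) u"
    and A: "openin (Rn N) A" "compactly_contained N A S"
    and S: "openin (Rn N) S" "compactly_contained N S (punctured_ball N R)"
    and x: "x \<in> A" and y: "y \<in> A"
  shows "u x - u y \<le>
    lipschitz_const p C (set_dist N A (Rn N frontier_of S)) (Linf_norm N S u) * edist N x y"
proof -
  define d where "d = set_dist N A (Rn N frontier_of S)"
  have subs: "S \<subseteq> Rn N closure_of S" "A \<subseteq> Rn N closure_of A"
    using closure_of_subset openin_subset A(1) S(1) by metis+
  have S\<Omega>: "S \<subseteq> punctured_ball N R" and AS: "A \<subseteq> S"
    using subs A(2) S(2) unfolding compactly_contained_def by blast+
  have At: "A \<subseteq> topspace (Rn N)"
    using A(1) by (rule openin_subset)
  have N: "0 < N"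
    using i by auto
  have front: "Rn N frontier_of S \<noteq> {}"
    using frontier_nonempty[OF N _ S\<Omega>] x AS by blast
  have d: "0 < d"
    unfolding d_def using set_dist_frontier_pos[OF S(1) A(2) At _ front] x by blast
  have ball: "{z \<in> topspace (Rn N). edist N x z < d} \<subseteq> S"
  proof
    fix z assume "z \<in> {z \<in> topspace (Rn N). edist N x z < d}"
    then show "z \<in> S"
      using eball_set_dist_frontier_subset[OF x subsetD[OF AS x] At, of z] by (simp add: d_def)
  qed
  have "origin N \<notin> S"
    using S\<Omega> by (auto simp: punctured_ball_def)
  moreover have "origin N \<in> topspace (Rn N)"
    by (simp add: origin_def)
  ultimately have "origin N \<notin> {z \<in> topspace (Rn N). edist N x z < d}"
    using ball by blast
  then have dx: "d \<le> enorm N x"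
    using \<open>origin N \<in> topspace (Rn N)\<close> by (simp add: edist_origin)
  have "bounded (u ` S)"
    using locally_bounded_on_imp_bounded[OF bdd] S(2) subs(1)
    unfolding compactly_contained_def by (meson bounded_subset image_mono)
  then obtain m where m: "m < Linf_norm N S u + 1"
      "AE x in lebesgue_Rn N. x \<in> S \<longrightarrow> \<bar>u x\<bar> \<le> m"
    using Linf_norm_AE_bound[of u S 1 N] by auto
  have L: "0 \<le> lipschitz_const p C d (Linf_norm N S u)"
    using lipschitz_const_ge_1[of p C d "Linf_norm N S u"] by linarith
  show ?thesis
    unfolding d_def[symmetric]
    by (rule one_sided_lipschitz[OF i usc rad sub S(1) S\<Omega> m(2) d dx ball L
        lipschitz_const_powr[OF p C d] lipschitz_const_oscillation[OF d less_imp_le[OF m(1)]]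
        subsetD[OF AS x] subsetD[OF AS y]])
qed

theorem proposition2p1:
  shows "\<exists>L :: real \<Rightarrow> real \<Rightarrow> real \<Rightarrow> real \<Rightarrow> real.
    \<forall>(N::nat) (i::nat) (R::real) (p::real) (C::real) (u :: (nat \<Rightarrow> real) \<Rightarrow> real).
      0 < R \<longrightarrow> i \<in> {1..N} \<longrightarrow> 1 < p \<longrightarrow> 0 \<le> C \<longrightarrow>
      usc_on N (punctured_ball N R) u \<longrightarrow>
      radial_on N (punctured_ball N R) u \<longrightarrow>
      locally_bounded_on N (punctured_ball N R) u \<longrightarrow>
      viscosity_subsolution N i p C (punctured_ball N R) u \<longrightarrow>
      (\<forall>\<omega> \<omega>'. openin (Rn N) \<omega> \<longrightarrow> openin (Rn N) \<omega>' \<longrightarrow>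
         compactly_contained N \<omega> \<omega>' \<longrightarrow>
         compactly_contained N \<omega>' (punctured_ball N R) \<longrightarrow>
         (let l = L p C (set_dist N \<omega> (Rn N frontier_of \<omega>')) (Linf_norm N \<omega>' u)
          in 0 < l \<and> (\<forall>x\<in>\<omega>. \<forall>y\<in>\<omega>. \<bar>u x - u y\<bar> \<le> l * edist N x y)))"
proof (rule exI[of _ lipschitz_const], unfold Let_def, intro allI impI conjI ballI)
  show "0 < lipschitz_const p C d M" for p C d M
    using lipschitz_const_ge_1[of p C d M] by linarith
next
  fix N i R p C u \<omega> \<omega>' x y
  let ?l = "lipschitz_const p C (set_dist N \<omega> (Rn N frontier_of \<omega>')) (Linf_norm N \<omega>' u)"
  assume "i \<in> {1..N}" "1 < p" "0 \<le> C"
    "usc_on N (punctured_ball N R) u" "radial_on N (punctured_ball N R) u"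
    "locally_bounded_on N (punctured_ball N R) u"
    "viscosity_subsolution N i p C (punctured_ball N R) u"
    "openin (Rn N) \<omega>" "openin (Rn N) \<omega>'" "compactly_contained N \<omega> \<omega>'"
    "compactly_contained N \<omega>' (punctured_ball N R)" "x \<in> \<omega>" "y \<in> \<omega>"
  note asms = this
  have "u x - u y \<le> ?l * edist N x y" "u y - u x \<le> ?l * edist N y x"
    using interior_lipschitz[OF asms(1-8,10,9,11)] asms(12,13) by blast+
  then show "\<bar>u x - u y\<bar> \<le> ?l * edist N x y"
    by (simp add: edist_commute abs_le_iff)
qed

end
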